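(* Let $A\subset\mathbb{R}^n$ be a finite set, $\Omega=\operatorname{conv}(A)$ a polytope with at least two points, and let $D>0$ be its diameter. Then $$\mathrm{SB}_{\mathrm{PFW}}(\Omega)\ \ge\ \tau_p:=\frac{\mathrm{PWidth}(A)}{D},\qquad \mathrm{SB}_{\mathrm{AFW}}(\Omega)\ \ge\ \frac{\tau_p}{2},\qquad \mathrm{SB}_{\mathrm{FD}}(\Omega)\ \ge\ \frac{\tau_v}{2}:=\frac{\mathrm{PFWidth}(\Omega)}{2D}.$$
   Context: $\|\cdot\|$ is the Euclidean norm and $\langle\cdot,\cdot\rangle$ the scalar product. For $x\in\Omega$, $T_\Omega(x)=\mathrm{cl}\{w:\exists\lambda>0,\ x+\lambda w\in\Omega\}$ is the tangent cone, $\pi(C,\cdot)$ is the Euclidean projection on a closed convex set $C$, and $\pi_x(g)=\|\pi(T_\Omega(x),g)\|$. Slope lower bound. A method $\mathcal{A}$ assigns to every $(x,g)\in\Omega\times\mathbb{R}^n$ a set $\mathcal{A}(x,g)$ of possible directions; $\mathcal{A}(x,g)=\{0\}$ if $\pi_x(g)=0$, and otherwise $\mathcal{A}(x,g)$ is a nonempty set of feasible directions $d$ at $x$ with $\langle g,d\rangle>0$. Define $\mathrm{DSB}_{\mathcal A}(\Omega,x,g)=\inf_{d\in\mathcal{A}(x,g)}\frac{\langle g,d\rangle}{\pi_x(g)\|d\|}$ if $\pi_x(g)\ne 0$ and $\mathrm{DSB}_{\mathcal A}(\Omega,x,g)=1$ if $\pi_x(g)=0$, and $\mathrm{SB}_{\mathcal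 A}(\Omega)=\inf_{x\in\Omega,\,g\in\mathbb{R}^n}\mathrm{DSB}_{\mathcal A}(\Omega,x,g)$. Methods. For $x\in\Omega$, $S_x$ is the family of sets $S\subset A$ such that $x$ is a proper convex combination (all coefficients strictly positive) of all the elements of $S$. When $\pi_x(g)\neq 0$ the possible directions are as follows. (PFW) all $d=s-q$ with $s\in\arg\max_{s\in\Omega}\langle s,g\rangle$ and $q\in\arg\min_{q\in S}\langle q,g\rangle$, for some $S\in S_x$. (AFW) all $d\in\arg\max\{\langle g,d\rangle: d\in\{d^{\mathrm{FW}},d^{\mathrm{AS}}\}\}$ with $d^{\mathrm{FW}}=s-x$, $s\in\arg\max_{s\in\Omega}\langle s,g\rangle$, and $d^{\mathrm{AS}}=x-q$, $q\in\arg\min_{q\in S}\langle q,g\rangle$, for some $S\in S_x$. (FDFW, subscript FD) all $d\in\arg\max\{\langle g,d\rangle: d\in\{d^{F},d^{\mathrm{FW}}\}\}$ with $d^{\mathrm{FW}}$ as before and $d^F=x-x_F$, $x_F\in\arg\min\{\langle g,y\rangle: y\in\mathcal{F}(x)\}$, where $\mathcal{F}(x)$ is the minimal face of $\Omega$ containing $x$. Widths. With $\mathrm{pfaces}(\Omega)$ the set of (nonempty) proper faces of $\Omega$ and $\operatorname{dist}(C,E)=\inf\{\|y-z\|:y\in C,z\in E\}$, $$\mathrm{PWidth}(A)=\min_{\mathcal F\in\mathrm{pfaces}(\Omega)}\operatorname{dist}(\mathcal F,\operatorname{conv}(A\setminus\mathcal F)),\qquad \mathrm{PFWidth}(\Omega)=\min_{\substack{\mathcal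 F_1,\mathcal F_2\in\mathrm{pfaces}(\Omega)\\ \mathcal F_1\cap\mathcal F_2=\emptyset}}\operatorname{dist}(\mathcal F_1,\mathcal F_2).$$ *)

theory Defs
  imports "HOL-Analysis.Analysis"
begin

definition tangent_cone :: "'a::euclidean_space set \<Rightarrow> 'a \<Rightarrow> 'a set" where
  "tangent_cone \<Omega> x = closure {w. \<exists>t>0. x + t *\<^sub>R w \<in> \<Omega>}"

definition proj_norm :: "'a::euclidean_space set \<Rightarrow> 'a \<Rightarrow> 'a \<Rightarrow> real" where
  "proj_norm \<Omega> x g = norm (closest_point (tangent_cone \<Omega> x) g)"

(* A method is a function sending (x, g) to the set of its possible directions.  For the methods
   below, on a polytope, the infima are over nonempty sets of nonnegative reals (whenever
   proj_norm \<Omega> x g \<noteq> 0 the set of directions is nonempty and g \<bullet> d > 0 for each of them), so the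
   real-valued Inf is the true infimum. *)
definition DSB ::
  "('a::euclidean_space \<Rightarrow> 'a \<Rightarrow> 'a set) \<Rightarrow> 'a set \<Rightarrow> 'a \<Rightarrow> 'a \<Rightarrow> real" where
  "DSB \<A> \<Omega> x g =
    (if proj_norm \<Omega> x g \<noteq> 0
     then INF d\<in>\<A> x g. (g \<bullet> d) / (proj_norm \<Omega> x g * norm d)
     else 1)"

definition SB :: "('a::euclidean_space \<Rightarrow> 'a \<Rightarrow> 'a set) \<Rightarrow> 'a set \<Rightarrow> real" where
  "SB \<A> \<Omega> = (INF (x, g)\<in>\<Omega> \<times> UNIV. DSB \<A> \<Omega> x g)"

(* The family S_x.  The weights are attached to the elements of S, all of which must get a
   positive weight; S is finite because sums over infinite sets are 0. *)
definition proper_supports :: "'a::euclidean_space set \<Rightarrow> 'a \<Rightarrow> 'a set set" where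
  "proper_supports A x =
    {S. S \<subseteq> A \<and>
        (\<exists>u. (\<forall>a\<in>S. 0 < u a) \<and> sum u S = 1 \<and> (\<Sum>a\<in>S. u a *\<^sub>R a) = x)}"

definition min_face :: "'a::euclidean_space set \<Rightarrow> 'a \<Rightarrow> 'a set" where
  "min_face \<Omega> x = \<Inter>{F. F face_of \<Omega> \<and> x \<in> F}"

lemma min_face_least:
  assumes "convex \<Omega>" "x \<in> \<Omega>"
  shows "min_face \<Omega> x face_of \<Omega>" "x \<in> min_face \<Omega> x"
    and "\<And>F. F face_of \<Omega> \<Longrightarrow> x \<in> F \<Longrightarrow> min_face \<Omega> x \<subseteq> F"
proof -
  have "{F. F face_of \<Omega> \<and> x \<in> F} \<noteq> {}"
    using assms face_of_refl by blast
  then show "min_face \<Omega> x face_of \<Omega>"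
    unfolding min_face_def by (intro face_of_Inter) auto
qed (auto simp: min_face_def)

definition PFW :: "'a::euclidean_space set \<Rightarrow> 'a \<Rightarrow> 'a \<Rightarrow> 'a set" where
  "PFW A x g =
    (if proj_norm (convex hull A) x g = 0 then {0}
     else {s - q | s q S.
             is_arg_max (\<lambda>y. g \<bullet> y) (\<lambda>y. y \<in> convex hull A) s \<and>
             S \<in> proper_supports A x \<and>
             is_arg_min (\<lambda>y. g \<bullet> y) (\<lambda>y. y \<in> S) q})"

definition AFW :: "'a::euclidean_space set \<Rightarrow> 'a \<Rightarrow> 'a \<Rightarrow> 'a set" where
  "AFW A x g =
    (if proj_norm (convex hull A) x g = 0 then {0}
     else {d. \<exists>s q S.
             is_arg_max (\<lambda>y. g \<bullet> y) (\<lambda>y. y \<in> convex hull A) s \<and>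
             S \<in> proper_supports A x \<and>
             is_arg_min (\<lambda>y. g \<bullet> y) (\<lambda>y. y \<in> S) q \<and>
             is_arg_max (\<lambda>e. g \<bullet> e) (\<lambda>e. e \<in> {s - x, x - q}) d})"

definition FDFW :: "'a::euclidean_space set \<Rightarrow> 'a \<Rightarrow> 'a \<Rightarrow> 'a set" where
  "FDFW \<Omega> x g =
    (if proj_norm \<Omega> x g = 0 then {0}
     else {d. \<exists>s x\<^sub>F.
             is_arg_max (\<lambda>y. g \<bullet> y) (\<lambda>y. y \<in> \<Omega>) s \<and>
             is_arg_min (\<lambda>y. g \<bullet> y) (\<lambda>y. y \<in> min_face \<Omega> x) x\<^sub>F \<and>
             is_arg_max (\<lambda>e. g \<bullet> e) (\<lambda>e. e \<in> {x - x\<^sub>F, s - x}) d})"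

definition pfaces :: "'a::euclidean_space set \<Rightarrow> 'a set set" where
  "pfaces \<Omega> = {F. F face_of \<Omega> \<and> F \<noteq> {} \<and> F \<noteq> \<Omega>}"

(* For a polytope with at least two points both minima are over finite nonempty sets (the vertices
   are proper faces), and setdist is only applied to nonempty sets: if A \<subseteq> F for a face F of
   convex hull A then F = convex hull A, so F is not proper. *)
definition PWidth :: "'a::euclidean_space set \<Rightarrow> real" where
  "PWidth A = Min ((\<lambda>F. setdist F (convex hull (A - F))) ` pfaces (convex hull A))"

definition PFWidth :: "'a::euclidean_space set \<Rightarrow> real" where
  "PFWidth \<Omega> =
    Min {setdist F\<^sub>1 F\<^sub>2 | F\<^sub>1 F\<^sub>2. F\<^sub>1 \<in> pfaces \<Omega> \<and> F\<^sub>2 \<in> pfaces \<Omega> \<and> F\<^sub>1 \<inter> F\<^sub>2 = {}}"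

end

theory Submission
  imports Defs
begin

text \<open>
  Let \<open>p\<close> be the projection of \<open>g\<close> on the tangent cone at \<open>x\<close>. The cone of feasible directions of
  a polytope is already closed, so \<open>p\<close> itself is feasible at \<open>x\<close>, and projecting on a closed convex
  cone gives \<open>g \<bullet> p = (norm p)\<^sup>2\<close>.

  The heart of the proof is \<open>longest_displacement\<close>. Given a polytope \<open>K\<close> containing \<open>x\<close>, consider all
  pairs \<open>w \<in> K\<close>, \<open>z \<in> \<Omega>\<close> whose difference \<open>z - w\<close> is a multiple \<open>l *\<^sub>R p\<close>, and take one with \<open>l\<close>
  largest. Then the minimal faces of \<open>z\<close> in \<open>\<Omega>\<close> and of \<open>w\<close> in \<open>K\<close> are disjoint: both points are in the
  relative interiors of their faces, so if the faces had a common point \<open>a\<close>, the segments from \<open>a\<close>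
  to \<open>z\<close> and to \<open>w\<close> could be prolonged in the same ratio \<open>1 + e\<close>, and the new end points would differ
  by \<open>(1 + e) * l\<close> times \<open>p\<close>.

  Disjointness turns the norm of \<open>z - w\<close> into an upper bound for the widths. For \<open>K = convex hull S\<close>
  with \<open>S \<subseteq> A\<close>, the minimal face of \<open>w\<close> is spanned by points of \<open>S\<close> outside the minimal face
  \<open>F\<close> of \<open>z\<close>, so \<open>w \<in> convex hull (A - F)\<close> and \<open>PWidth A \<le> norm (z - w)\<close>. For \<open>K\<close> the minimal
  face of \<open>x\<close>, both faces are faces of \<open>\<Omega>\<close>, so \<open>PFWidth \<Omega> \<le> norm (z - w)\<close>.

  Finally, if \<open>s\<close> maximizes \<open>g\<close> over \<open>\<Omega>\<close> and \<open>q\<close> minimizes \<open>g\<close> over \<open>K\<close> (or over \<open>S\<close>), then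
  \<open>g \<bullet> (s - q) \<ge> g \<bullet> (z - w) = l * (norm p)\<^sup>2 = norm (z - w) * norm p\<close>. This bounds the slope of the
  pairwise direction \<open>s - q\<close>, whose norm is at most \<open>D\<close>. The other two methods choose the better of
  \<open>s - x\<close> and \<open>x - q\<close>, which add up to \<open>s - q\<close>, so they keep at least half of this gain.
\<close>

section \<open>Minimal faces and tangent cones of polytopes\<close>

text \<open>The relative boundary of a polytope is covered by its facets; a facet of the minimal face that
  contained \<open>z\<close> would be a smaller face containing \<open>z\<close>.\<close>

lemma rel_interior_min_face:
  assumes "polytope P" "z \<in> P"
  shows "z \<in> rel_interior (min_face P z)"
proof (rule ccontr)
  assume "z \<notin> rel_interior (min_face P z)"
  note mf = min_face_least[OF polytope_imp_convex[OF assms(1)] assms(2)]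
  have "polyhedron (min_face P z)"
    using assms(1) mf(1) face_of_polytope_polytope polytope_imp_polyhedron by blast
  with \<open>z \<notin> _\<close> mf(2) obtain G where G: "G facet_of min_face P z" "z \<in> G"
    by (auto simp: rel_interior_of_polyhedron)
  then have "min_face P z \<subseteq> G"
    using mf(1,3) facet_of_imp_face_of face_of_trans by blast
  with G facet_of_imp_subset show False by fastforce
qed

text \<open>The whole interval of step lengths \<open>e\<close> is provided, rather than a single one, so that two
  points can be moved by the same \<open>e\<close>.\<close>

lemma extend_in_min_face:
  assumes "polytope P" "z \<in> P" "a \<in> min_face P z"
  obtains m where "m > 0" "\<And>e. 0 < e \<Longrightarrow> e \<le> m \<Longrightarrow> z + e *\<^sub>R (z - a) \<in> P"
proof -
  have face: "min_face P z face_of P"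
    using min_face_least(1) polytope_imp_convex assms by blast
  have "a \<in> affine hull (min_face P z)"
    using assms(3) by (rule hull_inc)
  then obtain m where "m > 1"
    and m: "\<And>e. e > 1 \<Longrightarrow> e \<le> m \<Longrightarrow> (1 - e) *\<^sub>R a + e *\<^sub>R z \<in> min_face P z"
    using convex_rel_interior_if[OF face_of_imp_convex[OF face]
        rel_interior_min_face[OF assms(1,2)]] by blast
  show thesis
  proof
    show "m - 1 > 0" using \<open>m > 1\<close> by simp
    fix e :: real assume "0 < e" "e \<le> m - 1"
    then have "(1 - (1 + e)) *\<^sub>R a + (1 + e) *\<^sub>R z \<in> min_face P z"
      by (intro m) auto
    moreover have "(1 - (1 + e)) *\<^sub>R a + (1 + e) *\<^sub>R z = z + e *\<^sub>R (z - a)"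
      by (simp add: algebra_simps)
    ultimately show "z + e *\<^sub>R (z - a) \<in> P"
      using face_of_imp_subset[OF face] by auto
  qed
qed

text \<open>The feasible directions form the cone generated by the vectors \<open>v - x\<close>, with \<open>v\<close> in a
  finite set that spans the polytope. Finitely generated cones are closed, so taking the closure adds nothing.\<close>

lemma tangent_cone_polytope:
  fixes P :: "'a::euclidean_space set"
  assumes "polytope P" "x \<in> P"
  shows "tangent_cone P x = {w. \<exists>t>0. x + t *\<^sub>R w \<in> P}"
    and "convex_cone (tangent_cone P x)"
proof -
  obtain V where V: "finite V" "P = convex hull V"
    using assms(1) polytope_def by blast
  define B where "B = (\<lambda>v. - x + v) ` V"
  have "V \<noteq> {}" using V assms(2) by auto
  have hull: "convex hull B = (\<lambda>v. - x + v) ` P"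
    unfolding B_def V(2) by (rule convex_hull_translation)
  have "w \<in> convex_cone hull B \<longleftrightarrow> (\<exists>t>0. x + t *\<^sub>R w \<in> P)" for w
  proof
    assume "w \<in> convex_cone hull B"
    moreover have "B \<noteq> {}" using \<open>V \<noteq> {}\<close> by (simp add: B_def)
    ultimately obtain b c where "b \<in> convex hull B" "c \<ge> 0" "w = c *\<^sub>R b"
      by (auto simp: convex_cone_hull_convex_hull_nonempty)
    then obtain v where v: "v \<in> P" "c \<ge> 0" "w = c *\<^sub>R (v - x)"
      unfolding hull by auto
    show "\<exists>t>0. x + t *\<^sub>R w \<in> P"
    proof (cases "c = 0")
      case True
      then show ?thesis using v assms(2) by (auto intro!: exI[of _ 1])
    next
      case False
      then show ?thesis using v by (auto intro!: exI[of _ "1 / c"])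
    qed
  next
    assume "\<exists>t>0. x + t *\<^sub>R w \<in> P"
    then obtain t where t: "t > 0" "x + t *\<^sub>R w \<in> P" by blast
    then have "t *\<^sub>R w \<in> convex hull B"
      unfolding hull by (auto intro!: image_eqI[of _ _ "x + t *\<^sub>R w"])
    moreover have "convex hull B \<subseteq> convex_cone hull B"
      by (intro hull_minimal hull_subset convex_convex_cone_hull)
    ultimately show "w \<in> convex_cone hull B"
      using convex_cone_scaleR[OF convex_cone_convex_cone_hull, of "1 / t" "t *\<^sub>R w" B] t
      by auto
  qed
  then have eq: "{w. \<exists>t>0. x + t *\<^sub>R w \<in> P} = convex_cone hull B" by blast
  moreover have "closed (convex_cone hull B)"
    using V by (intro closed_convex_cone_hull) (simp add: B_def)
  ultimately have eq': "tangent_cone P x = convex_cone hull B"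
    unfolding tangent_cone_def by simp
  show "tangent_cone P x = {w. \<exists>t>0. x + t *\<^sub>R w \<in> P}"
    using eq eq' by simp
  show "convex_cone (tangent_cone P x)"
    unfolding eq' by (rule convex_cone_convex_cone_hull)
qed

text \<open>The ray through the projection \<open>p\<close> stays in the cone, so \<open>p\<close> is also the point of this ray
  closest to \<open>g\<close>, and \<open>g - p\<close> is orthogonal to \<open>p\<close>. The variational inequality at \<open>0\<close> and at
  \<open>2 *\<^sub>R p\<close> gives the two halves of this.\<close>

lemma closest_point_convex_cone_dot:
  assumes "convex_cone T" "closed T"
  shows "g \<bullet> closest_point T g = (norm (closest_point T g))\<^sup>2"
proof -
  let ?p = "closest_point T g"
  have "convex T" using assms(1) by (simp add: convex_cone_def)
  have p: "?p \<in> T"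
    using closest_point_in_set[OF assms(2)] convex_cone_nonempty[OF assms(1)] by blast
  have "(g - ?p) \<bullet> (0 - ?p) \<le> 0"
    using closest_point_dot[OF \<open>convex T\<close> assms(2)] convex_cone_contains_0[OF assms(1)] by blast
  moreover have "(g - ?p) \<bullet> (2 *\<^sub>R ?p - ?p) \<le> 0"
    by (rule closest_point_dot[OF \<open>convex T\<close> assms(2)])
       (use convex_cone_scaleR[OF assms(1) _ p, of 2] in simp)
  ultimately show ?thesis
    by (simp add: power2_norm_eq_inner algebra_simps scaleR_2)
qed

section \<open>The longest displacement in a given direction\<close>

text \<open>The pair \<open>(x, x + t *\<^sub>R p)\<close> shows that the maximal displacement is nonzero. Disjointness of the
  minimal faces is the optimality condition: a common point would be the centre of a homothety
  of ratio greater than 1 that keeps \<open>w\<close> in \<open>K\<close> and \<open>z\<close> in \<open>P\<close> and lengthens the displacement.\<close>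

lemma longest_displacement:
  fixes K P :: "'a::euclidean_space set"
  assumes "polytope K" "polytope P" "x \<in> K" "t > 0" "x + t *\<^sub>R p \<in> P" "p \<noteq> 0"
  obtains w z l where "w \<in> K" "z \<in> P" "l > 0" "z - w = l *\<^sub>R p"
    "min_face P z \<inter> min_face K w = {}"
proof -
  \<comment> \<open>The equation says that \<open>z - w\<close> is a multiple of \<open>p\<close>, with the coefficient eliminated, so that
    the set of pairs is visibly closed. The sign of the coefficient is settled by maximality.\<close>
  define C where "C = (K \<times> P) \<inter> {u. (p \<bullet> p) *\<^sub>R (snd u - fst u) = (p \<bullet> (snd u - fst u)) *\<^sub>R p}"
  have "compact C"
    unfolding C_def
    by (intro compact_Int_closed compact_Times polytope_imp_compact assms closed_Collect_eq
        continuous_intros)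
  moreover have x: "(x, x + t *\<^sub>R p) \<in> C"
    using assms by (simp add: C_def)
  moreover have "continuous_on C (\<lambda>u. p \<bullet> (snd u - fst u))"
    by (intro continuous_intros)
  ultimately obtain u where u: "u \<in> C"
    and umax: "\<And>v. v \<in> C \<Longrightarrow> p \<bullet> (snd v - fst v) \<le> p \<bullet> (snd u - fst u)"
    using continuous_attains_sup[of C "\<lambda>u. p \<bullet> (snd u - fst u)"] by blast
  define w z where "w = fst u" and "z = snd u"
  define l where "l = (p \<bullet> (z - w)) / (p \<bullet> p)"
  have pp: "p \<bullet> p > 0" using assms by simp
  have wz: "w \<in> K" "z \<in> P" "(p \<bullet> p) *\<^sub>R (z - w) = (p \<bullet> (z - w)) *\<^sub>R p"
    using u by (auto simp: C_def w_def z_def)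
  have zw: "z - w = l *\<^sub>R p"
  proof -
    have "(1 / (p \<bullet> p)) *\<^sub>R ((p \<bullet> p) *\<^sub>R (z - w)) = l *\<^sub>R p"
      unfolding wz(3) l_def by simp
    then show ?thesis using pp by simp
  qed
  have "t * (p \<bullet> p) \<le> p \<bullet> (z - w)"
    using umax[OF x] by (simp add: w_def z_def)
  moreover have "0 < t * (p \<bullet> p)" using assms(4) pp by simp
  ultimately have "l > 0" using pp by (simp add: l_def)
  have "a \<notin> min_face K w" if a: "a \<in> min_face P z" for a
  proof
    assume "a \<in> min_face K w"
    then obtain m where m: "m > 0" "\<And>e. 0 < e \<Longrightarrow> e \<le> m \<Longrightarrow> w + e *\<^sub>R (w - a) \<in> K"
      using extend_in_min_face[OF assms(1) wz(1)] by metis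
    obtain m' where m': "m' > 0" "\<And>e. 0 < e \<Longrightarrow> e \<le> m' \<Longrightarrow> z + e *\<^sub>R (z - a) \<in> P"
      using extend_in_min_face[OF assms(2) wz(2) a] by metis
    define e where "e = min m m'"
    have "e > 0" using m m' by (simp add: e_def)
    let ?w = "w + e *\<^sub>R (w - a)" and ?z = "z + e *\<^sub>R (z - a)"
    have diff: "?z - ?w = (1 + e) *\<^sub>R (z - w)" by (simp add: algebra_simps)
    have "?w \<in> K" "?z \<in> P" using m m' \<open>e > 0\<close> by (auto simp: e_def)
    then have "(?w, ?z) \<in> C"
      unfolding C_def using diff by (simp add: zw)
    from umax[OF this] have "(1 + e) * (p \<bullet> (z - w)) \<le> p \<bullet> (z - w)"
      by (simp only: fst_conv snd_conv diff inner_scaleR_right w_def[symmetric] z_def[symmetric])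
    moreover have "p \<bullet> (z - w) > 0" using zw \<open>l > 0\<close> pp by simp
    ultimately show False using mult_pos_pos[OF \<open>e > 0\<close>] by (fastforce simp: distrib_right)
  qed
  then show thesis using that[OF wz(1,2) \<open>l > 0\<close> zw] by blast
qed

lemma pfaces_if_disjoint:
  assumes "F face_of P" "F \<noteq> {}" "G \<noteq> {}" "G \<subseteq> P" "F \<inter> G = {}"
  shows "F \<in> pfaces P"
  using assms by (auto simp: pfaces_def)

lemma finite_pfaces: "polytope P \<Longrightarrow> finite (pfaces P)"
  by (rule finite_subset[OF _ finite_polytope_faces]) (auto simp: pfaces_def)

text \<open>Only the generators of the minimal face of \<open>w\<close> in \<open>convex hull S\<close> are used to write \<open>w\<close> as a
  convex combination. None of them lies on the minimal face \<open>F\<close> of \<open>z\<close>, and so \<open>F\<close> is proper and its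
  distance to \<open>convex hull (A - F)\<close> is at most the length of the displacement.\<close>

lemma PWidth_le_displacement:
  fixes A S :: "'a::euclidean_space set"
  assumes "finite A" "S \<subseteq> A" "x \<in> convex hull S" "t > 0" "x + t *\<^sub>R p \<in> convex hull A" "p \<noteq> 0"
  obtains w z l where "w \<in> convex hull S" "z \<in> convex hull A" "l > 0" "z - w = l *\<^sub>R p"
    "PWidth A \<le> norm (z - w)"
proof -
  have pS: "polytope (convex hull S)" and pA: "polytope (convex hull A)"
    using assms finite_subset polytope_convex_hull by blast+
  obtain w z l where w: "w \<in> convex hull S" and z: "z \<in> convex hull A" and l: "l > 0"
    "z - w = l *\<^sub>R p"
    and disj: "min_face (convex hull A) z \<inter> min_face (convex hull S) w = {}"
    using longest_displacement[OF pS pA assms(3-6)] by blast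
  define F where "F = min_face (convex hull A) z"
  define G where "G = min_face (convex hull S) w"
  note F = min_face_least[OF polytope_imp_convex[OF pA] z, folded F_def]
  note G = min_face_least[OF polytope_imp_convex[OF pS] w, folded G_def]
  have "compact S" using assms finite_subset finite_imp_compact by blast
  then obtain S' where S': "S' \<subseteq> S" "G = convex hull S'"
    using face_of_convex_hull_subset G(1) by metis
  have "S' \<subseteq> G" unfolding S'(2) by (rule hull_subset)
  then have "S' \<subseteq> A - F" using S'(1) assms(2) disj F_def G_def by blast
  then have wA: "w \<in> convex hull (A - F)"
    using G(2) S'(2) hull_mono by blast
  have "G \<subseteq> convex hull A"
    unfolding S'(2) using S'(1) assms(2) by (intro hull_mono) auto
  then have "F \<in> pfaces (convex hull A)"
    using pfaces_if_disjoint[OF F(1), of G] F(2) G(2) disj F_def G_def by blast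
  then have "PWidth A \<le> setdist F (convex hull (A - F))"
    unfolding PWidth_def using finite_pfaces[OF pA] by (intro Min_le) auto
  also have "\<dots> \<le> norm (z - w)"
    using setdist_le_dist[OF F(2) wA] by (simp add: dist_norm)
  finally show thesis using that w z l by blast
qed

text \<open>Faces of the minimal face of \<open>x\<close> are faces of \<open>P\<close>. Two disjoint nonempty faces are both proper,
  so the minimal faces of \<open>z\<close> and \<open>w\<close> compete in the minimum that defines the width.\<close>

lemma PFWidth_le_displacement:
  fixes P :: "'a::euclidean_space set"
  assumes "polytope P" "x \<in> P" "t > 0" "x + t *\<^sub>R p \<in> P" "p \<noteq> 0"
  obtains w z l where "w \<in> min_face P x" "z \<in> P" "l > 0" "z - w = l *\<^sub>R p"
    "PFWidth P \<le> norm (z - w)"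
proof -
  let ?K = "min_face P x"
  note K = min_face_least[OF polytope_imp_convex[OF assms(1)] assms(2)]
  have pK: "polytope ?K" using face_of_polytope_polytope assms(1) K(1) by blast
  obtain w z l where w: "w \<in> ?K" and z: "z \<in> P" and l: "l > 0" "z - w = l *\<^sub>R p"
    and disj: "min_face P z \<inter> min_face ?K w = {}"
    using longest_displacement[OF pK assms(1) K(2) assms(3-5)] by blast
  define F where "F = min_face P z"
  define G where "G = min_face ?K w"
  note F = min_face_least[OF polytope_imp_convex[OF assms(1)] z, folded F_def]
  note G = min_face_least[OF polytope_imp_convex[OF pK] w, folded G_def]
  have GP: "G face_of P" using face_of_trans G(1) K(1) by blast
  have FG: "F \<inter> G = {}" using disj F_def G_def by blast
  have pf: "F \<in> pfaces P" "G \<in> pfaces P"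
    using pfaces_if_disjoint[OF F(1), of G] pfaces_if_disjoint[OF GP, of F] FG F(2) G(2)
      face_of_imp_subset[OF F(1)] face_of_imp_subset[OF GP] by blast+
  let ?D = "{setdist F\<^sub>1 F\<^sub>2 | F\<^sub>1 F\<^sub>2. F\<^sub>1 \<in> pfaces P \<and> F\<^sub>2 \<in> pfaces P \<and> F\<^sub>1 \<inter> F\<^sub>2 = {}}"
  have "?D \<subseteq> (\<lambda>(F\<^sub>1, F\<^sub>2). setdist F\<^sub>1 F\<^sub>2) ` (pfaces P \<times> pfaces P)" by auto
  then have "finite ?D"
    using finite_pfaces[OF assms(1)] finite_subset by blast
  moreover have "setdist F G \<in> ?D" using pf FG by blast
  ultimately have "PFWidth P \<le> setdist F G"
    unfolding PFWidth_def by (intro Min_le)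
  also have "\<dots> \<le> norm (z - w)"
    using setdist_le_dist[OF F(2) G(2)] by (simp add: dist_norm)
  finally show thesis using that w z l by blast
qed

section \<open>From displacements to slopes\<close>

lemma projected_direction:
  fixes P :: "'a::euclidean_space set"
  assumes "polytope P" "x \<in> P" "proj_norm P x g \<noteq> 0"
  obtains p t where "t > 0" "x + t *\<^sub>R p \<in> P" "p \<noteq> 0" "norm p = proj_norm P x g"
    "g \<bullet> p = (norm p)\<^sup>2"
proof -
  define p where "p = closest_point (tangent_cone P x) g"
  have closed: "closed (tangent_cone P x)" by (simp add: tangent_cone_def)
  have "p \<in> tangent_cone P x"
    unfolding p_def using closest_point_in_set[OF closed]
      convex_cone_nonempty[OF tangent_cone_polytope(2)[OF assms(1,2)]] by blast
  then obtain t where "t > 0" "x + t *\<^sub>R p \<in> P"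
    using tangent_cone_polytope(1)[OF assms(1,2)] by blast
  moreover have "g \<bullet> p = (norm p)\<^sup>2"
    unfolding p_def
    by (intro closest_point_convex_cone_dot closed tangent_cone_polytope(2)[OF assms(1,2)])
  ultimately show thesis
    using that[of t p] assms(3) by (auto simp: proj_norm_def p_def)
qed

text \<open>Since \<open>z - w\<close> is a positive multiple of \<open>p\<close>, and \<open>g\<close> and \<open>p\<close> have the same scalar product with
  \<open>p\<close>, the gain \<open>g \<bullet> (z - w)\<close> is exactly \<open>norm (z - w) * norm p\<close>.\<close>

lemma gain_of_displacement:
  assumes "z - w = l *\<^sub>R p" "l > 0" "g \<bullet> p = (norm p)\<^sup>2" "p \<noteq> 0" "W \<le> norm (z - w)"
  shows "0 < g \<bullet> z - g \<bullet> w" "W * norm p \<le> g \<bullet> z - g \<bullet> w"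
proof -
  have eq: "g \<bullet> z - g \<bullet> w = norm (z - w) * norm p"
    using assms(1-3) by (simp add: inner_diff_right[symmetric] power2_eq_square)
  show "0 < g \<bullet> z - g \<bullet> w" using eq assms by simp
  show "W * norm p \<le> g \<bullet> z - g \<bullet> w"
    unfolding eq using assms(5) by (rule mult_right_mono) simp
qed

lemma proper_support_in_hull:
  assumes "finite A" "S \<in> proper_supports A x"
  shows "S \<subseteq> A" "finite S" "x \<in> convex hull S" "S \<noteq> {}"
proof -
  show "S \<subseteq> A" using assms(2) by (simp add: proper_supports_def)
  then show "finite S" using assms(1) finite_subset by blast
  obtain u where u: "\<forall>a\<in>S. 0 < u a" "sum u S = 1" "(\<Sum>a\<in>S. u a *\<^sub>R a) = x"
    using assms(2) by (auto simp: proper_supports_def)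
  show "x \<in> convex hull S"
    unfolding convex_hull_finite[OF \<open>finite S\<close>] mem_Collect_eq
    using u by (intro exI[of _ u]) (simp add: less_imp_le)
  then show "S \<noteq> {}" by auto
qed

text \<open>Dropping the points of weight 0 from a convex combination leaves a proper one.\<close>

lemma proper_supports_nonempty:
  assumes "finite A" "x \<in> convex hull A"
  shows "proper_supports A x \<noteq> {}"
proof -
  obtain u where u: "\<forall>a\<in>A. 0 \<le> u a" "sum u A = 1" "(\<Sum>a\<in>A. u a *\<^sub>R a) = x"
    using assms(2) unfolding convex_hull_finite[OF assms(1)] by blast
  let ?S = "{a \<in> A. u a > 0}"
  have "sum u ?S = 1" "(\<Sum>a\<in>?S. u a *\<^sub>R a) = x"
    unfolding u(2,3)[symmetric]
    by (intro sum.mono_neutral_left; use assms(1) u(1) in force)+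
  then have "?S \<in> proper_supports A x" by (auto simp: proper_supports_def)
  then show ?thesis by blast
qed

text \<open>The longest displacement joins a point of \<open>convex hull S\<close> to a point of the polytope, and the
  pairwise direction \<open>s - q\<close> gains at least as much as any such displacement.\<close>

lemma PFW_gap:
  fixes A :: "'a::euclidean_space set"
  assumes "finite A" "x \<in> convex hull A" "proj_norm (convex hull A) x g \<noteq> 0"
    and s: "is_arg_max (\<lambda>y. g \<bullet> y) (\<lambda>y. y \<in> convex hull A) s"
    and S: "S \<in> proper_supports A x"
    and q: "is_arg_min (\<lambda>y. g \<bullet> y) (\<lambda>y. y \<in> S) q"
  shows "0 < g \<bullet> s - g \<bullet> q" "PWidth A * proj_norm (convex hull A) x g \<le> g \<bullet> s - g \<bullet> q"
proof -
  have pA: "polytope (convex hull A)" using assms polytope_convex_hull by blast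
  obtain p t where p: "t > 0" "x + t *\<^sub>R p \<in> convex hull A" "p \<noteq> 0"
    "norm p = proj_norm (convex hull A) x g" "g \<bullet> p = (norm p)\<^sup>2"
    using projected_direction[OF pA assms(2,3)] by blast
  note S' = proper_support_in_hull[OF assms(1) S]
  obtain w z l where w: "w \<in> convex hull S" and z: "z \<in> convex hull A" and l: "l > 0"
    "z - w = l *\<^sub>R p" "PWidth A \<le> norm (z - w)"
    using PWidth_le_displacement[OF assms(1) S'(1,3) p(1-3)] by blast
  have "S \<subseteq> {y. g \<bullet> q \<le> g \<bullet> y}" using q by (auto simp: is_arg_min_linorder)
  then have "convex hull S \<subseteq> {y. g \<bullet> q \<le> g \<bullet> y}"
    using convex_halfspace_ge[where a = g and b = "g \<bullet> q"] by (intro hull_minimal) simp_all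
  then have "g \<bullet> q \<le> g \<bullet> w" using w by auto
  moreover have "g \<bullet> z \<le> g \<bullet> s" using s z by (auto simp: is_arg_max_linorder)
  ultimately show "0 < g \<bullet> s - g \<bullet> q"
    "PWidth A * proj_norm (convex hull A) x g \<le> g \<bullet> s - g \<bullet> q"
    using gain_of_displacement[OF l(2,1) p(5,3) l(3)] p(4) by auto
qed

text \<open>The same comparison, with the minimal face of \<open>x\<close> as the set in which displacements start.\<close>

lemma FDFW_gap:
  fixes P :: "'a::euclidean_space set"
  assumes "polytope P" "x \<in> P" "proj_norm P x g \<noteq> 0"
    and s: "is_arg_max (\<lambda>y. g \<bullet> y) (\<lambda>y. y \<in> P) s"
    and q: "is_arg_min (\<lambda>y. g \<bullet> y) (\<lambda>y. y \<in> min_face P x) q"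
  shows "0 < g \<bullet> s - g \<bullet> q" "PFWidth P * proj_norm P x g \<le> g \<bullet> s - g \<bullet> q"
proof -
  obtain p t where p: "t > 0" "x + t *\<^sub>R p \<in> P" "p \<noteq> 0"
    "norm p = proj_norm P x g" "g \<bullet> p = (norm p)\<^sup>2"
    using projected_direction[OF assms(1-3)] by blast
  obtain w z l where w: "w \<in> min_face P x" and z: "z \<in> P" and l: "l > 0"
    "z - w = l *\<^sub>R p" "PFWidth P \<le> norm (z - w)"
    using PFWidth_le_displacement[OF assms(1,2) p(1-3)] by blast
  have "g \<bullet> q \<le> g \<bullet> w" using q w by (auto simp: is_arg_min_linorder)
  moreover have "g \<bullet> z \<le> g \<bullet> s" using s z by (auto simp: is_arg_max_linorder)
  ultimately show "0 < g \<bullet> s - g \<bullet> q" "PFWidth P * proj_norm P x g \<le> g \<bullet> s - g \<bullet> q"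
    using gain_of_displacement[OF l(2,1) p(5,3) l(3)] p(4) by auto
qed

lemma better_of_two_gain:
  fixes g :: "'a::real_inner"
  assumes "is_arg_max (\<lambda>e. g \<bullet> e) (\<lambda>e. e \<in> {s - x, x - q}) d"
  shows "g \<bullet> s - g \<bullet> q \<le> 2 * (g \<bullet> d)"
  using assms by (auto simp: is_arg_max_linorder inner_diff_right)

lemma compact_has_arg_max:
  fixes g :: "'a::euclidean_space"
  assumes "compact K" "K \<noteq> {}"
  shows "\<exists>s. is_arg_max (\<lambda>y. g \<bullet> y) (\<lambda>y. y \<in> K) s"
  using continuous_attains_sup[OF assms, of "\<lambda>y. g \<bullet> y"]
  by (auto simp: is_arg_max_linorder continuous_intros)

lemma compact_has_arg_min:
  fixes g :: "'a::euclidean_space"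
  assumes "compact K" "K \<noteq> {}"
  shows "\<exists>s. is_arg_min (\<lambda>y. g \<bullet> y) (\<lambda>y. y \<in> K) s"
  using continuous_attains_inf[OF assms, of "\<lambda>y. g \<bullet> y"]
  by (auto simp: is_arg_min_linorder continuous_intros)

text \<open>A gain proportional to the projected gradient bounds the slope because directions have norm at
  most \<open>D\<close>. The hypothesis \<open>c \<le> D\<close> covers the stationary pairs, where \<open>DSB\<close> is 1; nonemptiness
  makes the infimum over the directions a genuine one.\<close>

lemma SB_ge:
  fixes P :: "'a::euclidean_space set"
  assumes "P \<noteq> {}" "D > 0" "c \<le> D"
    and nonempty: "\<And>x g. x \<in> P \<Longrightarrow> proj_norm P x g \<noteq> 0 \<Longrightarrow> \<A> x g \<noteq> {}"
    and slope: "\<And>x g d. x \<in> P \<Longrightarrow> proj_norm P x g \<noteq> 0 \<Longrightarrow> d \<in> \<A> x g \<Longrightarrow>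
      0 < g \<bullet> d \<and> c * proj_norm P x g \<le> g \<bullet> d \<and> norm d \<le> D"
  shows "c / D \<le> SB \<A> P"
proof -
  have "c / D \<le> DSB \<A> P x g" if x: "x \<in> P" for x g
  proof (cases "proj_norm P x g = 0")
    case True
    then show ?thesis using assms by (simp add: DSB_def)
  next
    case False
    let ?r = "proj_norm P x g"
    have r: "?r > 0" using False by (simp add: proj_norm_def)
    have "c / D \<le> (g \<bullet> d) / (?r * norm d)" if d: "d \<in> \<A> x g" for d
    proof -
      note sl = slope[OF x False d]
      then have "norm d > 0" by auto
      have "c / D = (c * ?r) / (?r * D)" using r by simp
      also have "\<dots> \<le> (g \<bullet> d) / (?r * D)"
        using sl r \<open>D > 0\<close> by (intro divide_right_mono) auto
      also have "\<dots> \<le> (g \<bullet> d) / (?r * norm d)"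
        using sl r \<open>norm d > 0\<close> \<open>D > 0\<close>
        by (intro divide_left_mono mult_left_mono mult_pos_pos) auto
      finally show ?thesis .
    qed
    then show ?thesis
      using False nonempty[OF x False] by (auto simp: DSB_def intro!: cINF_greatest)
  qed
  then show ?thesis
    unfolding SB_def using assms(1) by (intro cINF_greatest) auto
qed

section \<open>Slope bounds for the three methods\<close>

theorem proposition3p1:
  fixes A \<Omega> :: "(real ^ 'n) set" and D \<tau>\<^sub>p \<tau>\<^sub>v :: real
  assumes "finite A"
    and "\<Omega> = convex hull A"
    and "\<exists>x\<in>\<Omega>. \<exists>y\<in>\<Omega>. x \<noteq> y"
    and "D = diameter \<Omega>"
    and "\<tau>\<^sub>p = PWidth A / D"
    and "\<tau>\<^sub>v = PFWidth \<Omega> / D"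
  shows "SB (PFW A) \<Omega> \<ge> \<tau>\<^sub>p \<and> SB (AFW A) \<Omega> \<ge> \<tau>\<^sub>p / 2 \<and> SB (FDFW \<Omega>) \<Omega> \<ge> \<tau>\<^sub>v / 2"
proof -
  have poly: "polytope \<Omega>" using assms polytope_convex_hull by blast
  note cpt = polytope_imp_compact[OF poly]
  have D: "norm (y - z) \<le> D" if "y \<in> \<Omega>" "z \<in> \<Omega>" for y z
    using diameter_bounded_bound[OF polytope_imp_bounded[OF poly] that] assms(4)
    by (simp add: dist_norm)
  have AO: "A \<subseteq> \<Omega>" unfolding assms(2) by (rule hull_subset)
  obtain x\<^sub>0 y\<^sub>0 where xy: "x\<^sub>0 \<in> \<Omega>" "y\<^sub>0 \<in> \<Omega>" "x\<^sub>0 \<noteq> y\<^sub>0" using assms(3) by blast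
  have ne: "\<Omega> \<noteq> {}" using xy by blast
  have "0 < norm (y\<^sub>0 - x\<^sub>0)" using xy by simp
  then have Dpos: "D > 0" using D xy by (metis less_le_trans)
  have dir: "x\<^sub>0 + 1 *\<^sub>R (y\<^sub>0 - x\<^sub>0) \<in> \<Omega>" "y\<^sub>0 - x\<^sub>0 \<noteq> 0" using xy by auto
  \<comment> \<open>At stationary pairs the bound reads \<open>PWidth A \<le> D\<close>. It follows from the displacement lemma with
    an arbitrary nonzero feasible direction, and likewise for \<open>PFWidth\<close>.\<close>
  have pw: "PWidth A \<le> D"
  proof -
    obtain w z where "w \<in> convex hull A" "z \<in> convex hull A" "PWidth A \<le> norm (z - w)"
      using PWidth_le_displacement[OF assms(1) order_refl xy(1)[unfolded assms(2)] zero_less_one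
          dir[unfolded assms(2)]] by blast
    then show ?thesis using D[of z w] assms(2) by auto
  qed
  have pfw: "PFWidth \<Omega> \<le> D"
  proof -
    obtain w z where "w \<in> min_face \<Omega> x\<^sub>0" "z \<in> \<Omega>" "PFWidth \<Omega> \<le> norm (z - w)"
      using PFWidth_le_displacement[OF poly xy(1) zero_less_one dir] by blast
    moreover have "min_face \<Omega> x\<^sub>0 \<subseteq> \<Omega>"
      using min_face_least(1)[OF polytope_imp_convex[OF poly] xy(1)] by (rule face_of_imp_subset)
    ultimately show ?thesis using D[of z w] by auto
  qed
  have exS: "\<exists>s q S. is_arg_max (\<lambda>y. g \<bullet> y) (\<lambda>y. y \<in> convex hull A) s \<and>
      S \<in> proper_supports A x \<and> is_arg_min (\<lambda>y. g \<bullet> y) (\<lambda>y. y \<in> S) q"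
    if x: "x \<in> \<Omega>" for x g
  proof -
    obtain S where S: "S \<in> proper_supports A x"
      using proper_supports_nonempty[OF assms(1)] x assms(2) by blast
    then show ?thesis
      using compact_has_arg_max[OF cpt ne, of g] compact_has_arg_min[of S g]
        proper_support_in_hull[OF assms(1) S] finite_imp_compact assms(2) by blast
  qed
  have ex2: "\<exists>d. is_arg_max (\<lambda>e. g \<bullet> e) (\<lambda>e. e \<in> {a, b}) d" for g a b :: "real^'n"
    by (intro compact_has_arg_max finite_imp_compact) auto
  have "PWidth A / D \<le> SB (PFW A) \<Omega>"
  proof (rule SB_ge[OF ne Dpos pw])
    fix x g :: "real^'n" assume x: "x \<in> \<Omega>" "proj_norm \<Omega> x g \<noteq> 0"
    show "PFW A x g \<noteq> {}"
      using exS[OF x(1), of g] x(2) assms(2) by (auto simp: PFW_def)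
    fix d assume "d \<in> PFW A x g"
    then obtain s q S where d: "d = s - q"
      and s: "is_arg_max (\<lambda>y. g \<bullet> y) (\<lambda>y. y \<in> convex hull A) s"
      and S: "S \<in> proper_supports A x" and q: "is_arg_min (\<lambda>y. g \<bullet> y) (\<lambda>y. y \<in> S) q"
      using x(2) assms(2) by (auto simp: PFW_def)
    have "s \<in> \<Omega>" "q \<in> \<Omega>"
      using s q proper_support_in_hull(1)[OF assms(1) S] AO assms(2)
      by (auto simp: is_arg_max_def is_arg_min_def)
    then show "0 < g \<bullet> d \<and> PWidth A * proj_norm \<Omega> x g \<le> g \<bullet> d \<and> norm d \<le> D"
      using PFW_gap[OF assms(1) x[unfolded assms(2)] s S q] D[of s q]
      by (simp add: d assms(2) inner_diff_right)
  qed
  moreover have "(PWidth A / 2) / D \<le> SB (AFW A) \<Omega>"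
  proof (rule SB_ge[OF ne Dpos])
    show "PWidth A / 2 \<le> D" using pw Dpos by linarith
    fix x g :: "real^'n" assume x: "x \<in> \<Omega>" "proj_norm \<Omega> x g \<noteq> 0"
    show "AFW A x g \<noteq> {}"
      using exS[OF x(1), of g] x(2) assms(2) ex2 by (simp add: AFW_def) blast
    fix d assume "d \<in> AFW A x g"
    then obtain s q S where
      s: "is_arg_max (\<lambda>y. g \<bullet> y) (\<lambda>y. y \<in> convex hull A) s"
      and S: "S \<in> proper_supports A x" and q: "is_arg_min (\<lambda>y. g \<bullet> y) (\<lambda>y. y \<in> S) q"
      and d: "is_arg_max (\<lambda>e. g \<bullet> e) (\<lambda>e. e \<in> {s - x, x - q}) d"
      using x(2) assms(2) by (auto simp: AFW_def)
    have "s \<in> \<Omega>" "q \<in> \<Omega>"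
      using s q proper_support_in_hull(1)[OF assms(1) S] AO assms(2)
      by (auto simp: is_arg_max_def is_arg_min_def)
    then have "norm d \<le> D"
      using d D x(1) by (auto simp: is_arg_max_def)
    then show "0 < g \<bullet> d \<and> PWidth A / 2 * proj_norm \<Omega> x g \<le> g \<bullet> d \<and> norm d \<le> D"
      using PFW_gap[OF assms(1) x[unfolded assms(2)] s S q] better_of_two_gain[OF d]
      by (simp add: assms(2))
  qed
  moreover have "(PFWidth \<Omega> / 2) / D \<le> SB (FDFW \<Omega>) \<Omega>"
  proof (rule SB_ge[OF ne Dpos])
    show "PFWidth \<Omega> / 2 \<le> D" using pfw Dpos by linarith
    fix x g :: "real^'n" assume x: "x \<in> \<Omega>" "proj_norm \<Omega> x g \<noteq> 0"
    note F = min_face_least[OF polytope_imp_convex[OF poly] x(1)]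
    have "compact (min_face \<Omega> x)"
      using face_of_imp_compact[OF polytope_imp_convex[OF poly] cpt F(1)] .
    then have "\<exists>q. is_arg_min (\<lambda>y. g \<bullet> y) (\<lambda>y. y \<in> min_face \<Omega> x) q"
      using F(2) by (intro compact_has_arg_min) auto
    then show "FDFW \<Omega> x g \<noteq> {}"
      using compact_has_arg_max[OF cpt ne, of g] x(2) ex2 by (simp add: FDFW_def) blast
    fix d assume "d \<in> FDFW \<Omega> x g"
    then obtain s q where s: "is_arg_max (\<lambda>y. g \<bullet> y) (\<lambda>y. y \<in> \<Omega>) s"
      and q: "is_arg_min (\<lambda>y. g \<bullet> y) (\<lambda>y. y \<in> min_face \<Omega> x) q"
      and d: "is_arg_max (\<lambda>e. g \<bullet> e) (\<lambda>e. e \<in> {s - x, x - q}) d"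
      using x(2) by (auto simp: FDFW_def insert_commute)
    have "s \<in> \<Omega>" "q \<in> \<Omega>"
      using s q face_of_imp_subset[OF F(1)] by (auto simp: is_arg_max_def is_arg_min_def)
    then have "norm d \<le> D"
      using d D x(1) by (auto simp: is_arg_max_def)
    then show "0 < g \<bullet> d \<and> PFWidth \<Omega> / 2 * proj_norm \<Omega> x g \<le> g \<bullet> d \<and> norm d \<le> D"
      using FDFW_gap[OF poly x s q] better_of_two_gain[OF d] by simp
  qed
  ultimately show ?thesis using assms(5,6) by (simp add: mult.commute)
qed

end
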